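(* For every $n \ge 1$, in every $(P_3)^3$-packing of $Q_n$ at least $\log_2 n$ vertices of $Q_n$ are uncovered.
   Context: $Q_n$ is the $n$-dimensional hypercube on $\{0,1\}^n$ (vertices adjacent iff they differ in exactly one coordinate). $P_l$ is the path on $l$ vertices. For graphs $G_1,G_2$, the Cartesian product $G_1\times G_2$ has vertex set $V(G_1)\times V(G_2)$, with $(u_1,u_2)$ adjacent to $(v_1,v_2)$ iff either $u_1=v_1$ and $u_2v_2\in E(G_2)$, or $u_2=v_2$ and $u_1v_1\in E(G_1)$; $G^t$ denotes the product of $t$ copies of $G$. A $(P_3)^3$-packing of $Q_n$ is a collection of pairwise vertex-disjoint subgraphs of $Q_n$ each isomorphic to $(P_3)^3$; a vertex is uncovered if it lies in none of them. *)

theory Defs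
  imports Complex_Main "HOL-Library.FuncSet" "HOL-Library.Disjoint_Sets"
begin

record 'a ugraph =
  verts :: "'a set"
  edges :: "'a set set"

definition simple_graph :: "'a ugraph \<Rightarrow> bool" where
  "simple_graph G \<longleftrightarrow> (\<forall>e\<in>edges G. e \<subseteq> verts G \<and> card e = 2)"

definition is_subgraph :: "'a ugraph \<Rightarrow> 'a ugraph \<Rightarrow> bool" where
  "is_subgraph H G \<longleftrightarrow> simple_graph H \<and> verts H \<subseteq> verts G \<and> edges H \<subseteq> edges G"

definition isomorphic :: "'a ugraph \<Rightarrow> 'b ugraph \<Rightarrow> bool" where
  "isomorphic G H \<longleftrightarrow>
    (\<exists>f. bij_betw f (verts G) (verts H) \<and>
      (\<forall>u\<in>verts G. \<forall>v\<in>verts G. {u, v} \<in> edges G \<longleftrightarrow> {f u, f v} \<in> edges H))"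

definition hypercube :: "nat \<Rightarrow> (nat \<Rightarrow> nat) ugraph" where
  "hypercube n =
    (let V = {..<n} \<rightarrow>\<^sub>E {0, 1} in
     \<lparr>verts = V, edges = {{x, y} | x y. x \<in> V \<and> y \<in> V \<and> card {i. i < n \<and> x i \<noteq> y i} = 1}\<rparr>)"

(* The parameter is the number of vertices, not the number of edges. *)
definition path_graph :: "nat \<Rightarrow> nat ugraph" where
  "path_graph l = \<lparr>verts = {..<l}, edges = {{i, Suc i} | i. Suc i < l}\<rparr>"

definition cart_prod :: "'a ugraph \<Rightarrow> 'b ugraph \<Rightarrow> ('a \<times> 'b) ugraph" where
  "cart_prod G1 G2 =
    (let V = verts G1 \<times> verts G2 in
     \<lparr>verts = V,
      edges = {{(u1, u2), (v1, v2)} | u1 u2 v1 v2.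
        (u1, u2) \<in> V \<and> (v1, v2) \<in> V \<and>
        (u1 = v1 \<and> {u2, v2} \<in> edges G2 \<or> u2 = v2 \<and> {u1, v1} \<in> edges G1)}\<rparr>)"

definition third_power :: "'a ugraph \<Rightarrow> (('a \<times> 'a) \<times> 'a) ugraph" where
  "third_power G = cart_prod (cart_prod G G) G"

(* disjoint_family_on ranges over distinct members of the set F.  A set, rather than a
   multiset, of subgraphs suffices when T has a vertex, since then no copy can occur twice. *)
definition is_packing :: "'b ugraph \<Rightarrow> 'a ugraph \<Rightarrow> 'a ugraph set \<Rightarrow> bool" where
  "is_packing T G F \<longleftrightarrow>
    (\<forall>H\<in>F. is_subgraph H G \<and> isomorphic H T) \<and> disjoint_family_on verts F"

definition uncovered :: "'a ugraph \<Rightarrow> 'a ugraph set \<Rightarrow> 'a set" where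
  "uncovered G F = verts G - (\<Union>H\<in>F. verts H)"

end

(* If every uncovered vertex had equal entries at two coordinates i and j, then the subcube
   x_i = 0, x_j = 1 would be partitioned by the copies of (P_3)^3.  In a square of the hypercube
   opposite edges have the same direction, so on a copy each coordinate depends on only one
   of the three path parameters; hence the coordinates i, j leave one parameter free, and the copy
   meets the subcube in a multiple of 3 vertices.  But the subcube has 2^(n-2) vertices.  So the
   uncovered vertices separate the n coordinates, and n is at most 2^(number uncovered). *)
theory Submission
  imports Defs
begin

section \<open>Edges and squares of the hypercube\<close>

lemma hypercube_edgeD:
  assumes "{x, y} \<in> edges (hypercube n)"
  shows "\<exists>p. {x p, y p} = {0, 1} \<and> (\<forall>i. x i \<noteq> y i \<longleftrightarrow> i = p)"
proof -
  have *: "\<exists>p. {u p, v p} = {0, 1} \<and> (\<forall>i. u i \<noteq> v i \<longleftrightarrow> i = p)"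
    if uv: "u \<in> {..<n} \<rightarrow>\<^sub>E {0, 1::nat}" "v \<in> {..<n} \<rightarrow>\<^sub>E {0, 1::nat}"
      and c: "card {i. i < n \<and> u i \<noteq> v i} = 1" for u v
  proof -
    have "{i. i < n \<and> u i \<noteq> v i} = {i. u i \<noteq> v i}"
      using uv by (auto simp: PiE_iff extensional_def) (metis not_le)
    then obtain p where p: "{i. i < n \<and> u i \<noteq> v i} = {p}" "{i. u i \<noteq> v i} = {p}"
      using c by (auto simp: card_1_singleton_iff)
    then have "p < n" "u p \<noteq> v p"
      by auto
    then have "{u p, v p} = {0, 1}"
      using uv[THEN PiE_mem, of p] by auto
    with p(2) show ?thesis
      by blast
  qed
  from assms obtain u v where "{x, y} = {u, v}"
      "\<exists>p. {u p, v p} = {0, 1} \<and> (\<forall>i. u i \<noteq> v i \<longleftrightarrow> i = p)"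
    unfolding hypercube_def Let_def using * by auto
  then show ?thesis
    by (metis doubleton_eq_iff)
qed

text \<open>Around a closed walk each binary coordinate flips an even number of times. Distinct
  opposite corners force adjacent edges to have different directions, so the flips of a coordinate
  can only be paired on opposite edges. The conclusion is phrased for a single coordinate, so that
  it fits the coordinate functions on a copy.\<close>

lemma hypercube_square:
  assumes xy: "{x, y} \<in> edges (hypercube n)" and yz: "{y, z} \<in> edges (hypercube n)"
    and wz: "{w, z} \<in> edges (hypercube n)" and xw: "{x, w} \<in> edges (hypercube n)"
    and "x \<noteq> z" "y \<noteq> w"
  shows "(x i = y i \<and> w i = z i) \<or> (x i = w i \<and> y i = z i)"
proof -
  obtain p where p01: "{x p, y p} = {0, 1}" and p: "\<And>i. x i \<noteq> y i \<longleftrightarrow> i = p"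
    using hypercube_edgeD[OF xy] by blast
  obtain q where q01: "{y q, z q} = {0, 1}" and q: "\<And>i. y i \<noteq> z i \<longleftrightarrow> i = q"
    using hypercube_edgeD[OF yz] by blast
  obtain r where r01: "{w r, z r} = {0, 1}" and r: "\<And>i. w i \<noteq> z i \<longleftrightarrow> i = r"
    using hypercube_edgeD[OF wz] by blast
  obtain s where s: "\<And>i. x i \<noteq> w i \<longleftrightarrow> i = s"
    using hypercube_edgeD[OF xw] by blast
  \<comment> \<open>Flipping the same binary entry on two consecutive edges would lead back to the
    start; this is where the entries being 0 or 1 matters.\<close>
  have "p \<noteq> q"
  proof
    assume "p = q"
    then have "x p = z p"
      using p01 q01 by (auto simp: doubleton_eq_iff)
    then have "x = z"
      using p q \<open>p = q\<close> by (intro ext) metis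
    with \<open>x \<noteq> z\<close> show False ..
  qed
  have "q \<noteq> r"
  proof
    assume "q = r"
    then have "y q = w q"
      using q01 r01 by (auto simp: doubleton_eq_iff)
    then have "y = w"
      using q r \<open>q = r\<close> by (intro ext) metis
    with \<open>y \<noteq> w\<close> show False ..
  qed
  \<comment> \<open>If \<open>r \<noteq> p\<close>, coordinate \<open>p\<close> changes on
    \<open>xy\<close> but neither on \<open>yz\<close> nor on \<open>wz\<close>, so it must change
    on \<open>xw\<close>, giving \<open>s = p\<close>. The same argument for coordinate
    \<open>r\<close> gives \<open>s = r\<close>, a contradiction.\<close>
  have "r = p"
  proof (rule ccontr)
    assume "r \<noteq> p"
    then show False using p q r s \<open>r \<noteq> p\<close> \<open>p \<noteq> q\<close> \<open>q \<noteq> r\<close> by metis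
  qed
  then show ?thesis using p q r s \<open>p \<noteq> q\<close> by metis
qed

section \<open>Functions and subsets of a three-dimensional grid\<close>

text \<open>In either alternative for a unit square, parallel sides agree on whether
  \<open>g\<close> is constant along them. Thus constancy of a step is a property of its axis and
  its position on that axis alone, and steps along two different axes cannot both be non-constant,
  as they span a common square.\<close>

lemma grid_depends_on_one:
  fixes g :: "nat \<Rightarrow> nat \<Rightarrow> nat \<Rightarrow> 'b"
  assumes ab: "\<And>a b c. \<lbrakk>Suc a < l; Suc b < l; c < l\<rbrakk> \<Longrightarrow>
      (g a b c = g (Suc a) b c \<and> g a (Suc b) c = g (Suc a) (Suc b) c) \<or>
      (g a b c = g a (Suc b) c \<and> g (Suc a) b c = g (Suc a) (Suc b) c)"
    and ac: "\<And>a b c. \<lbrakk>Suc a < l; b < l; Suc c < l\<rbrakk> \<Longrightarrow>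
      (g a b c = g (Suc a) b c \<and> g a b (Suc c) = g (Suc a) b (Suc c)) \<or>
      (g a b c = g a b (Suc c) \<and> g (Suc a) b c = g (Suc a) b (Suc c))"
    and bc: "\<And>a b c. \<lbrakk>a < l; Suc b < l; Suc c < l\<rbrakk> \<Longrightarrow>
      (g a b c = g a (Suc b) c \<and> g a b (Suc c) = g a (Suc b) (Suc c)) \<or>
      (g a b c = g a b (Suc c) \<and> g a (Suc b) c = g a (Suc b) (Suc c))"
  defines "A \<equiv> \<forall>a<l. \<forall>b<l. \<forall>c<l. g a b c = g 0 b c"
    and "B \<equiv> \<forall>a<l. \<forall>b<l. \<forall>c<l. g a b c = g a 0 c"
    and "C \<equiv> \<forall>a<l. \<forall>b<l. \<forall>c<l. g a b c = g a b 0"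
  shows "(A \<and> B) \<or> (A \<and> C) \<or> (B \<and> C)"
proof -
  \<comment> \<open>\<open>P\<close>, \<open>Q\<close> and \<open>R\<close> test the unit steps on
    the three axes through the origin; the next three facts carry the tests to all parallel steps,
    one perpendicular direction at a time.\<close>
  define P where "P a \<longleftrightarrow> g a 0 0 = g (Suc a) 0 0" for a
  define Q where "Q b \<longleftrightarrow> g 0 b 0 = g 0 (Suc b) 0" for b
  define R where "R c \<longleftrightarrow> g 0 0 c = g 0 0 (Suc c)" for c
  have P: "g a b c = g (Suc a) b c \<longleftrightarrow> P a" if "Suc a < l" "b < l" "c < l" for a b c
  proof -
    have "g a b 0 = g (Suc a) b 0 \<longleftrightarrow> P a" using that(2)
    proof (induction b)
      case (Suc b) then show ?case using ab[of a b 0] that(1) by force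
    qed (simp add: P_def)
    with that(3) show ?thesis
    proof (induction c)
      case (Suc c) then show ?case using ac[of a b c] that(1,2) by force
    qed simp
  qed
  have Q: "g a b c = g a (Suc b) c \<longleftrightarrow> Q b" if "a < l" "Suc b < l" "c < l" for a b c
  proof -
    have "g a b 0 = g a (Suc b) 0 \<longleftrightarrow> Q b" using that(1)
    proof (induction a)
      case (Suc a) then show ?case using ab[of a b 0] that(2) by force
    qed (simp add: Q_def)
    with that(3) show ?thesis
    proof (induction c)
      case (Suc c) then show ?case using bc[of a b c] that(1,2) by force
    qed simp
  qed
  have R: "g a b c = g a b (Suc c) \<longleftrightarrow> R c" if "a < l" "b < l" "Suc c < l" for a b c
  proof -
    have "g a 0 c = g a 0 (Suc c) \<longleftrightarrow> R c" using that(1)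
    proof (induction a)
      case (Suc a) then show ?case using ac[of a 0 c] that(3) by force
    qed (simp add: R_def)
    with that(2) show ?thesis
    proof (induction b)
      case (Suc b) then show ?case using bc[of a b c] that(1,3) by force
    qed simp
  qed
  have PQ: "P a \<or> Q b" if "Suc a < l" "Suc b < l" for a b
    using ab[of a b 0] P[of a b 0] Q[of a b 0] that by fastforce
  have PR: "P a \<or> R c" if "Suc a < l" "Suc c < l" for a c
    using ac[of a 0 c] P[of a 0 c] R[of a 0 c] that by fastforce
  have QR: "Q b \<or> R c" if "Suc b < l" "Suc c < l" for b c
    using bc[of 0 b c] Q[of 0 b c] R[of 0 b c] that by fastforce
  have A if "\<forall>a. Suc a < l \<longrightarrow> P a"
  proof -
    have "g a b c = g 0 b c" if "a < l" "b < l" "c < l" for a b c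
      using that(1)
    proof (induction a)
      case (Suc a) then show ?case using P[of a b c] \<open>\<forall>a. _\<close> that(2,3) by simp
    qed simp
    then show ?thesis unfolding A_def by blast
  qed
  moreover have B if "\<forall>b. Suc b < l \<longrightarrow> Q b"
  proof -
    have "g a b c = g a 0 c" if "a < l" "b < l" "c < l" for a b c
      using that(2)
    proof (induction b)
      case (Suc b) then show ?case using Q[of a b c] \<open>\<forall>b. _\<close> that(1,3) by simp
    qed simp
    then show ?thesis unfolding B_def by blast
  qed
  moreover have C if "\<forall>c. Suc c < l \<longrightarrow> R c"
  proof -
    have "g a b c = g a b 0" if "a < l" "b < l" "c < l" for a b c
      using that(3)
    proof (induction c)
      case (Suc c) then show ?case using R[of a b c] \<open>\<forall>c. _\<close> that(1,2) by simp
    qed simp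
    then show ?thesis unfolding C_def by blast
  qed
  \<comment> \<open>A single failing \<open>P a\<close> forces all \<open>Q b\<close> and all
    \<open>R c\<close>, hence \<open>B\<close> and \<open>C\<close>. If every \<open>P a\<close>
    holds, then \<open>A\<close> holds, and a failing \<open>Q b\<close> forces all
    \<open>R c\<close>; so at most one axis has a non-constant step.\<close>
  ultimately show ?thesis
    using PQ PR QR by blast
qed

text \<open>The set is a union of full lines along the axis that \<open>S\<close> ignores, and each
  line has \<open>l\<close> points. Each case writes it as the product of \<open>{..<l}\<close> with
  a two-dimensional slice.\<close>

lemma dvd_card_grid:
  fixes S :: "nat \<Rightarrow> nat \<Rightarrow> nat \<Rightarrow> bool"
  assumes "(\<forall>a<l. \<forall>b<l. \<forall>c<l. S a b c = S 0 b c) \<or>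
    (\<forall>a<l. \<forall>b<l. \<forall>c<l. S a b c = S a 0 c) \<or>
    (\<forall>a<l. \<forall>b<l. \<forall>c<l. S a b c = S a b 0)"
  shows "l dvd card {((a, b), c). a < l \<and> b < l \<and> c < l \<and> S a b c}" (is "_ dvd card ?M")
  using assms
proof (elim disjE)
  assume "\<forall>a<l. \<forall>b<l. \<forall>c<l. S a b c = S 0 b c"
  then have "?M = {((a, b), c). a < l \<and> b < l \<and> c < l \<and> S 0 b c}"
    by blast
  moreover have "bij_betw (\<lambda>(a, b, c). ((a, b), c))
      ({..<l} \<times> {(b, c). b < l \<and> c < l \<and> S 0 b c})
      {((a, b), c). a < l \<and> b < l \<and> c < l \<and> S 0 b c}"
    by (auto simp: bij_betw_def inj_on_def image_def)
  ultimately show ?thesis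
    by (auto dest!: bij_betw_same_card[symmetric] simp: card_cartesian_product)
next
  assume "\<forall>a<l. \<forall>b<l. \<forall>c<l. S a b c = S a 0 c"
  then have "?M = {((a, b), c). a < l \<and> b < l \<and> c < l \<and> S a 0 c}"
    by blast
  moreover have "bij_betw (\<lambda>(b, a, c). ((a, b), c))
      ({..<l} \<times> {(a, c). a < l \<and> c < l \<and> S a 0 c})
      {((a, b), c). a < l \<and> b < l \<and> c < l \<and> S a 0 c}"
    by (auto simp: bij_betw_def inj_on_def image_def)
  ultimately show ?thesis
    by (auto dest!: bij_betw_same_card[symmetric] simp: card_cartesian_product)
next
  assume "\<forall>a<l. \<forall>b<l. \<forall>c<l. S a b c = S a b 0"
  then have "?M = {((a, b), c). a < l \<and> b < l \<and> c < l \<and> S a b 0}"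
    by blast
  moreover have "bij_betw (\<lambda>(c, a, b). ((a, b), c))
      ({..<l} \<times> {(a, b). a < l \<and> b < l \<and> S a b 0})
      {((a, b), c). a < l \<and> b < l \<and> c < l \<and> S a b 0}"
    by (auto simp: bij_betw_def inj_on_def image_def)
  ultimately show ?thesis
    by (auto dest!: bij_betw_same_card[symmetric] simp: card_cartesian_product)
qed

section \<open>The third power of a path as a grid\<close>

lemma verts_cart_prod: "verts (cart_prod G1 G2) = verts G1 \<times> verts G2"
  by (simp add: cart_prod_def Let_def)

lemma edge_cart_prodI:
  "\<lbrakk>u \<in> verts G1; u2 \<in> verts G2; v2 \<in> verts G2; {u2, v2} \<in> edges G2\<rbrakk>
    \<Longrightarrow> {(u, u2), (u, v2)} \<in> edges (cart_prod G1 G2)"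
  "\<lbrakk>u1 \<in> verts G1; v1 \<in> verts G1; w \<in> verts G2; {u1, v1} \<in> edges G1\<rbrakk>
    \<Longrightarrow> {(u1, w), (v1, w)} \<in> edges (cart_prod G1 G2)"
  unfolding cart_prod_def Let_def ugraph.simps mem_Collect_eq by blast+

lemma verts_path_graph: "verts (path_graph l) = {..<l}"
  by (simp add: path_graph_def)

lemma edge_path_graph: "Suc a < l \<Longrightarrow> {a, Suc a} \<in> edges (path_graph l)"
  by (auto simp: path_graph_def)

lemma verts_third_power_path:
  "verts (third_power (path_graph l)) = {((a, b), c). a < l \<and> b < l \<and> c < l}"
  by (auto simp: third_power_def verts_cart_prod verts_path_graph)

lemma edges_third_power_path:
  "\<lbrakk>Suc a < l; b < l; c < l\<rbrakk> \<Longrightarrow> {((a, b), c), ((Suc a, b), c)} \<in> edges (third_power (path_graph l))"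
  "\<lbrakk>a < l; Suc b < l; c < l\<rbrakk> \<Longrightarrow> {((a, b), c), ((a, Suc b), c)} \<in> edges (third_power (path_graph l))"
  "\<lbrakk>a < l; b < l; Suc c < l\<rbrakk> \<Longrightarrow> {((a, b), c), ((a, b), Suc c)} \<in> edges (third_power (path_graph l))"
  by (auto simp: third_power_def verts_cart_prod verts_path_graph
      intro!: edge_cart_prodI edge_path_graph)

section \<open>Copies of the grid in the hypercube and their traces on subcubes\<close>

lemma dvd_card_copy_Int_subcube:
  assumes sub: "is_subgraph H (hypercube n)" and iso: "isomorphic H (third_power (path_graph l))"
  shows "l dvd card (verts H \<inter> {x. x i = u \<and> x j = v})"
proof -
  let ?T = "third_power (path_graph l)"
  obtain f where f: "bij_betw f (verts H) (verts ?T)"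
    and fe: "\<And>x y. \<lbrakk>x \<in> verts H; y \<in> verts H\<rbrakk> \<Longrightarrow> {x, y} \<in> edges H \<longleftrightarrow> {f x, f y} \<in> edges ?T"
    using iso unfolding isomorphic_def by blast
  define h where "h = inv_into (verts H) f"
  have h: "bij_betw h (verts ?T) (verts H)"
    unfolding h_def by (rule bij_betw_inv_into[OF f])
  have fh: "f (h t) = t" if "t \<in> verts ?T" for t
    using bij_betw_inv_into_right[OF f that] by (simp add: h_def)
  \<comment> \<open>The isomorphism pulls a grid edge back to an edge of \<open>H\<close>, which is
    an edge of the hypercube because \<open>H\<close> is a subgraph.\<close>
  have he: "{h s, h t} \<in> edges (hypercube n)"
    if "{s, t} \<in> edges ?T" "s \<in> verts ?T" "t \<in> verts ?T" for s t
    using fe[of "h s" "h t"] that fh h sub by (auto simp: is_subgraph_def bij_betw_apply)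
  have hne: "h s \<noteq> h t" if "s \<noteq> t" "s \<in> verts ?T" "t \<in> verts ?T" for s t
    using fh that by metis
  \<comment> \<open>The inverse isomorphism parametrizes the copy by grid points; \<open>g k\<close>
    is coordinate \<open>k\<close> of the vertex, as a function of the three path
    parameters.\<close>
  define g where "g k a b c = h ((a, b), c) k" for k a b c
  \<comment> \<open>Grid squares go to hypercube squares, and injectivity of \<open>h\<close> keeps
    their opposite corners distinct.\<close>
  have sq: "(h s k = h t k \<and> h t' k = h u k) \<or> (h s k = h t' k \<and> h t k = h u k)"
    if "{s, t} \<in> edges ?T" "{t, u} \<in> edges ?T" "{t', u} \<in> edges ?T" "{s, t'} \<in> edges ?T"
      "s \<noteq> u" "t \<noteq> t'" "s \<in> verts ?T" "t \<in> verts ?T" "t' \<in> verts ?T" "u \<in> verts ?T" for k s t t' u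
    by (rule hypercube_square[where n = n]) (use that he hne in auto)
  have sq_ab: "(g k a b c = g k (Suc a) b c \<and> g k a (Suc b) c = g k (Suc a) (Suc b) c) \<or>
      (g k a b c = g k a (Suc b) c \<and> g k (Suc a) b c = g k (Suc a) (Suc b) c)"
    if "Suc a < l" "Suc b < l" "c < l" for k a b c
    unfolding g_def by (rule sq) (use that in \<open>auto intro: edges_third_power_path simp: verts_third_power_path\<close>)
  have sq_ac: "(g k a b c = g k (Suc a) b c \<and> g k a b (Suc c) = g k (Suc a) b (Suc c)) \<or>
      (g k a b c = g k a b (Suc c) \<and> g k (Suc a) b c = g k (Suc a) b (Suc c))"
    if "Suc a < l" "b < l" "Suc c < l" for k a b c
    unfolding g_def by (rule sq) (use that in \<open>auto intro: edges_third_power_path simp: verts_third_power_path\<close>)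
  have sq_bc: "(g k a b c = g k a (Suc b) c \<and> g k a b (Suc c) = g k a (Suc b) (Suc c)) \<or>
      (g k a b c = g k a b (Suc c) \<and> g k a (Suc b) c = g k a (Suc b) (Suc c))"
    if "a < l" "Suc b < l" "Suc c < l" for k a b c
    unfolding g_def by (rule sq) (use that in \<open>auto intro: edges_third_power_path simp: verts_third_power_path\<close>)
  have dep: "((\<forall>a<l. \<forall>b<l. \<forall>c<l. g k a b c = g k 0 b c) \<and> (\<forall>a<l. \<forall>b<l. \<forall>c<l. g k a b c = g k a 0 c)) \<or>
      ((\<forall>a<l. \<forall>b<l. \<forall>c<l. g k a b c = g k 0 b c) \<and> (\<forall>a<l. \<forall>b<l. \<forall>c<l. g k a b c = g k a b 0)) \<or>
      ((\<forall>a<l. \<forall>b<l. \<forall>c<l. g k a b c = g k a 0 c) \<and> (\<forall>a<l. \<forall>b<l. \<forall>c<l. g k a b c = g k a b 0))" for k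
    by (rule grid_depends_on_one) (fact sq_ab sq_ac sq_bc)+
  have S_cong: "(g i a b c = u \<and> g j a b c = v) = (g i a' b' c' = u \<and> g j a' b' c' = v)"
    if "g i a b c = g i a' b' c'" "g j a b c = g j a' b' c'" for a b c a' b' c'
    using that by simp
  \<comment> \<open>Pigeonhole: two pairs chosen from three axes share an axis. Along it both
    coordinates \<open>i\<close> and \<open>j\<close> are constant, and so is membership in the
    subcube.\<close>
  have majority: "(A \<and> A') \<or> (B \<and> B') \<or> (C \<and> C')"
    if "(A \<and> B) \<or> (A \<and> C) \<or> (B \<and> C)" "(A' \<and> B') \<or> (A' \<and> C') \<or> (B' \<and> C')" for A B C A' B' C'
    using that by blast
  let ?S = "\<lambda>a b c. g i a b c = u \<and> g j a b c = v"
  let ?M = "{((a, b), c). a < l \<and> b < l \<and> c < l \<and> ?S a b c}"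
  have "(\<forall>a<l. \<forall>b<l. \<forall>c<l. ?S a b c = ?S 0 b c) \<or>
    (\<forall>a<l. \<forall>b<l. \<forall>c<l. ?S a b c = ?S a 0 c) \<or>
    (\<forall>a<l. \<forall>b<l. \<forall>c<l. ?S a b c = ?S a b 0)"
    using majority[OF dep[of i] dep[of j]]
  proof (elim disjE conjE, goal_cases)
    case 1
    then show ?case by (intro disjI1 allI impI S_cong) blast+
  next
    case 2
    then show ?case by (intro disjI2[OF disjI1] allI impI S_cong) blast+
  next
    case 3
    then show ?case by (intro disjI2[OF disjI2] allI impI S_cong) blast+
  qed
  then have "l dvd card ?M"
    by (rule dvd_card_grid)
  \<comment> \<open>\<open>h\<close> carries the counted grid points to the trace of the copy on the
    subcube, so divisibility passes to the trace.\<close>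
  moreover have "bij_betw h ?M (verts H \<inter> {x. x i = u \<and> x j = v})"
  proof (rule bij_betw_subset[OF h])
    have M: "?M = {t \<in> verts ?T. h t i = u \<and> h t j = v}"
      by (auto simp: verts_third_power_path g_def)
    show "?M \<subseteq> verts ?T"
      by (auto simp: verts_third_power_path)
    have "h ` {t \<in> verts ?T. h t i = u \<and> h t j = v} = h ` verts ?T \<inter> {x. x i = u \<and> x j = v}"
      by auto
    then show "h ` ?M = verts H \<inter> {x. x i = u \<and> x j = v}"
      by (simp only: M bij_betw_imp_surj_on[OF h])
  qed
  ultimately show ?thesis
    by (simp only: bij_betw_same_card)
qed

section \<open>Uncovered vertices separate the coordinates\<close>

lemma uncovered_meets_subcube:
  assumes pack: "is_packing (third_power (path_graph 3)) (hypercube n) F"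
    and ij: "i < n" "j < n" "i \<noteq> j"
  shows "\<exists>x \<in> uncovered (hypercube n) F. x i = 0 \<and> x j = 1"
proof (rule ccontr)
  assume none: "\<not> ?thesis"
  let ?A = "{x. x i = (0::nat) \<and> x j = (1::nat)}" and ?V = "verts (hypercube n)"
  let ?C = "(\<lambda>H. verts H \<inter> ?A) ` F"
  have V: "?V = {..<n} \<rightarrow>\<^sub>E {0, 1}"
    by (simp add: hypercube_def Let_def)
  have sub: "is_subgraph H (hypercube n)" "isomorphic H (third_power (path_graph 3))"
    if "H \<in> F" for H
    using pack that by (auto simp: is_packing_def)
  \<comment> \<open>By \<open>none\<close>, no vertex of the subcube is uncovered, so the traces of
    the copies fill it.\<close>
  have un: "\<Union>?C = ?V \<inter> ?A"
  proof
    show "\<Union>?C \<subseteq> ?V \<inter> ?A"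
      using sub(1) unfolding is_subgraph_def by blast
    show "?V \<inter> ?A \<subseteq> \<Union>?C"
      using none unfolding uncovered_def by blast
  qed
  have fin: "finite ?V"
    by (simp add: V finite_PiE)
  have "disjoint_family_on (\<lambda>H. verts H \<inter> ?A) F"
    using pack by (auto simp: is_packing_def disjoint_family_on_def)
  then have "disjoint ?C"
    by (rule disjoint_family_on_disjoint_image)
  then have dvd: "3 dvd card (\<Union>?C)"
    using fin un by (intro dvd_partition)
      (auto simp: disjoint_def intro: dvd_card_copy_Int_subcube[OF sub, where v = 1, simplified])
  \<comment> \<open>Written as a product with singletons at the two fixed positions, the subcube can
    be counted by \<open>card_PiE\<close>. Since \<open>i \<noteq> j\<close>, the first branch does
    not override the value prescribed at \<open>j\<close>.\<close>
  have "?V \<inter> ?A = PiE {..<n} (\<lambda>k. if k = i then {0} else if k = j then {1} else {0, 1})"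
  proof (intro set_eqI iffI)
    fix x assume "x \<in> ?V \<inter> ?A"
    then show "x \<in> PiE {..<n} (\<lambda>k. if k = i then {0} else if k = j then {1} else {0, 1})"
      by (auto simp: V PiE_iff)
  next
    fix x :: "nat \<Rightarrow> nat" assume x: "x \<in> PiE {..<n} (\<lambda>k. if k = i then {0} else if k = j then {1} else {0, 1})"
    then show "x \<in> ?V \<inter> ?A"
      using ij PiE_mem[OF x, of i] PiE_mem[OF x, of j] by (auto simp: V PiE_iff split: if_splits)
  qed
  \<comment> \<open>The factors of the cardinality are 1 at \<open>i\<close> and \<open>j\<close>
    and 2 elsewhere, so coprimality to 3 is checked factor by factor and the power of 2 need not be
    evaluated.\<close>
  moreover have "coprime 3 (Suc (Suc 0))"
    by (metis coprime_Suc_left_nat numeral_2_eq_2 numeral_3_eq_3)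
  ultimately have "coprime 3 (card (?V \<inter> ?A))"
    by (auto simp: card_PiE intro!: prod_coprime_right)
  then show False
    using dvd un by (auto simp: coprime_absorb_left)
qed

theorem theorem2:
  fixes n :: nat and F :: "(nat \<Rightarrow> nat) ugraph set"
  assumes "n \<ge> 1"
    and "is_packing (third_power (path_graph 3)) (hypercube n) F"
  shows "real (card (uncovered (hypercube n) F)) \<ge> log 2 (real n)"
proof -
  let ?U = "uncovered (hypercube n) F"
  have fin: "finite ?U"
    by (simp add: uncovered_def hypercube_def Let_def finite_PiE)
  \<comment> \<open>Coordinate \<open>i\<close> is encoded by the set of uncovered vertices that
    vanish there. An uncovered vertex with entry 0 at \<open>i\<close> and 1 at \<open>j\<close>
    lies in the set for \<open>i\<close> but not in the set for \<open>j\<close>; hence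
    \<open>n\<close> is at most the number of subsets of \<open>?U\<close>.\<close>
  have "inj_on (\<lambda>i. {x \<in> ?U. x i = 0}) {..<n}"
  proof (rule inj_onI, rule ccontr)
    fix i j assume "i \<in> {..<n}" "j \<in> {..<n}" "i \<noteq> j" and eq: "{x \<in> ?U. x i = 0} = {x \<in> ?U. x j = 0}"
    then obtain x where "x \<in> ?U" "x i = 0" "x j = 1"
      using uncovered_meets_subcube[OF assms(2)] by blast
    moreover from this have "x \<in> {x \<in> ?U. x j = 0}"
      unfolding eq[symmetric] by blast
    ultimately show False by simp
  qed
  then have "card {..<n} \<le> card (Pow ?U)"
    using fin by (intro card_inj_on_le) auto
  then have "n \<le> 2 ^ card ?U"
    using fin by (simp add: card_Pow)
  then have "real n \<le> 2 ^ card ?U"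
    by (metis of_nat_le_iff of_nat_numeral of_nat_power)
  then show ?thesis
    using assms(1) by (subst log_le_iff) (auto simp: powr_realpow)
qed

end
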